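(* Let $B^K_t=\int_0^t K(t,s)\,\mathrm{d}W_s$, $t\in[0,T]$, be a Volterra process whose $L^2$ kernel $K$ satisfies, for some $H\in(0,1)$ and $c\in(0,\infty)$, $\big(\int_{t-\varepsilon}^t K(t,s)^2\,\mathrm{d}s\big)^{1/2}\ge c\,\varepsilon^H$ for all $t\in(0,T]$ and $\varepsilon\in(0,t)$. Let $x_0\in\mathbb{R}$. Assume that there exist $m\in\mathbb{N}$, countable sets $M_1,\dots,M_m\subset\mathbb{R}$, and functions $f_1,\dots,f_m$ with $f_i\in L^{q_i}(\mathbb{R})$, for $q_1,\dots,q_m\in(1,\infty]$, such that $$b(t,x)=b(x)=\sum_{i=1}^m f_i(x)\,\mathbf{1}_{M_i}(x),\qquad x\in\mathbb{R}.$$ Then the SDE $$\mathrm{d}X_t=b(t,X_t)\,\mathrm{d}t+\mathrm{d}B^K_t,\quad t\in[0,T],\qquad X_0=x_0,$$ admits a strong solution. Furthermore, if the functions $f_i$ are bounded, the solution is unique.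
   Context: $T\in(0,\infty)$ is fixed, $(\Omega,(\mathcal{A}_t)_{t\in[0,T]},\mathbb{P})$ is a filtered probability space, $(W_t)_{t\in[0,T]}$ is a standard one-dimensional Brownian motion on it, and $(\mathcal{A}_t)$ is the augmented filtration generated by $W$, satisfying the usual conditions. An $L^2$ kernel is a function $K\colon[0,T]\times[0,T]\to\mathbb{R}$ with $\int_0^T\int_0^T K(t,s)^2\,\mathrm{d}t\,\mathrm{d}s<\infty$ (the Wiener integrals defining $B^K_t$ are assumed well defined for each $t$). The $f_i$ are genuine (pointwise defined) measurable functions $\mathbb{R}\to\mathbb{R}$. A strong solution is an $(\mathcal{A}_t)$-adapted process $X$ on the given space with $X_t=x_0+\int_0^t b(s,X_s)\,\mathrm{d}s+B^K_t$, $t\in[0,T]$, almost surely; uniqueness means that any two ($(\mathcal{A}_t)$-adapted) solutions coincide for every $t\in[0,T]$ almost surely. *)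

theory Defs
  imports "HOL-Probability.Probability"
begin

section \<open>Filtered probability spaces and Brownian motion on \<open>[0, T]\<close>\<close>

text \<open>
  Filtrations and processes are functions on \<open>real\<close>; only their values at times
  in \<open>[0, T]\<close> matter.
\<close>

definition filtered_prob_space :: "'w measure \<Rightarrow> real \<Rightarrow> (real \<Rightarrow> 'w measure) \<Rightarrow> bool" where
  "filtered_prob_space P T A \<longleftrightarrow>
     prob_space P \<and>
     (\<forall>t\<in>{0..T}. subalgebra P (A t)) \<and>
     (\<forall>s\<in>{0..T}. \<forall>t\<in>{0..T}. s \<le> t \<longrightarrow> sets (A s) \<subseteq> sets (A t))"

definition usual_conditions :: "'w measure \<Rightarrow> real \<Rightarrow> (real \<Rightarrow> 'w measure) \<Rightarrow> bool" where
  "usual_conditions P T A \<longleftrightarrow>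
     complete_measure P \<and>
     null_sets P \<subseteq> sets (A 0) \<and>
     (\<forall>t\<in>{0..<T}. sets (A t) = (\<Inter>s\<in>{t<..T}. sets (A s)))"

definition adapted :: "real \<Rightarrow> (real \<Rightarrow> 'w measure) \<Rightarrow> (real \<Rightarrow> 'w \<Rightarrow> real) \<Rightarrow> bool" where
  "adapted T A X \<longleftrightarrow> (\<forall>t\<in>{0..T}. X t \<in> borel_measurable (A t))"

definition brownian_motion ::
    "'w measure \<Rightarrow> real \<Rightarrow> (real \<Rightarrow> 'w measure) \<Rightarrow> (real \<Rightarrow> 'w \<Rightarrow> real) \<Rightarrow> bool" where
  "brownian_motion P T A W \<longleftrightarrow>
     adapted T A W \<and>
     (AE \<omega> in P. W 0 \<omega> = 0) \<and>
     (AE \<omega> in P. continuous_on {0..T} (\<lambda>t. W t \<omega>)) \<and>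
     (\<forall>s t. 0 \<le> s \<longrightarrow> s < t \<longrightarrow> t \<le> T \<longrightarrow>
        distributed P lborel (\<lambda>\<omega>. W t \<omega> - W s \<omega>) (normal_density 0 (sqrt (t - s))) \<and>
        prob_space.indep_set P
          (sets (vimage_algebra (space P) (\<lambda>\<omega>. W t \<omega> - W s \<omega>) borel)) (sets (A s)))"

definition augmented_filtration ::
    "'w measure \<Rightarrow> (real \<Rightarrow> 'w \<Rightarrow> real) \<Rightarrow> real \<Rightarrow> 'w measure" where
  "augmented_filtration P W t =
     sigma (space P)
       (null_sets P \<union> {W s -` S \<inter> space P | s S. s \<in> {0..t} \<and> S \<in> sets borel})"

section \<open>Wiener integrals and Volterra processes\<close>

text \<open>
  A list of triples \<open>(a, u, v)\<close> represents the step function that is the sum of the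
  functions \<open>a \<cdot> 1\<^bsub>(u, v]\<^esub>\<close>.
\<close>

definition step_fun :: "(real \<times> real \<times> real) list \<Rightarrow> real \<Rightarrow> real" where
  "step_fun p s = (\<Sum>(a, u, v)\<leftarrow>p. a * indicator {u<..v} s)"

definition step_integral ::
    "(real \<Rightarrow> 'w \<Rightarrow> real) \<Rightarrow> (real \<times> real \<times> real) list \<Rightarrow> 'w \<Rightarrow> real" where
  "step_integral W p \<omega> = (\<Sum>(a, u, v)\<leftarrow>p. a * (W v \<omega> - W u \<omega>))"

text \<open>
  \<open>I\<close> is a version of the Wiener integral of \<open>g\<close> over \<open>[0, t]\<close>: an \<open>L\<^sup>2(P)\<close>-limit of
  integrals of step functions that approximate \<open>g\<close> in \<open>L\<^sup>2([0, t])\<close>. By the Wiener isometry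
  the limit does not depend, up to null sets, on the approximating sequence.
\<close>

definition wiener_integral ::
    "'w measure \<Rightarrow> (real \<Rightarrow> 'w \<Rightarrow> real) \<Rightarrow> real \<Rightarrow> (real \<Rightarrow> real) \<Rightarrow> ('w \<Rightarrow> real) \<Rightarrow> bool" where
  "wiener_integral P W t g I \<longleftrightarrow>
     set_borel_measurable lebesgue {0..t} g \<and>
     set_integrable lebesgue {0..t} (\<lambda>s. (g s)\<^sup>2) \<and>
     I \<in> borel_measurable P \<and>
     (\<exists>p :: nat \<Rightarrow> (real \<times> real \<times> real) list.
        (\<forall>n. \<forall>(a, u, v)\<in>set (p n). 0 \<le> u \<and> u \<le> v \<and> v \<le> t) \<and>
        ((\<lambda>n. \<integral>\<^sup>+ s\<in>{0..t}. ennreal ((g s - step_fun (p n) s)\<^sup>2) \<partial>lebesgue) \<longlonglongrightarrow> 0) \<and>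
        ((\<lambda>n. \<integral>\<^sup>+ \<omega>. ennreal ((I \<omega> - step_integral W (p n) \<omega>)\<^sup>2) \<partial>P) \<longlonglongrightarrow> 0))"

definition L2_kernel :: "real \<Rightarrow> (real \<Rightarrow> real \<Rightarrow> real) \<Rightarrow> bool" where
  "L2_kernel T K \<longleftrightarrow>
     set_borel_measurable lebesgue ({0..T} \<times> {0..T}) (\<lambda>(t, s). K t s) \<and>
     set_integrable lebesgue ({0..T} \<times> {0..T}) (\<lambda>(t, s). (K t s)\<^sup>2)"

text \<open>
  The Wiener integrals determine the process only up to modification at each time. As usual for
  a process entering an integral in time, a jointly measurable version is taken (no continuity of
  paths is required); for an arbitrary modification the paths need not be measurable, so that the
  drift integral of the SDE need not make sense.
\<close>

definition volterra_process ::
    "'w measure \<Rightarrow> real \<Rightarrow> (real \<Rightarrow> 'w \<Rightarrow> real) \<Rightarrow> (real \<Rightarrow> real \<Rightarrow> real) \<Rightarrow>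
     (real \<Rightarrow> 'w \<Rightarrow> real) \<Rightarrow> bool" where
  "volterra_process P T W K B \<longleftrightarrow>
     (\<lambda>(t, \<omega>). B t \<omega>) \<in> borel_measurable (restrict_space borel {0..T} \<Otimes>\<^sub>M P) \<and>
     (\<forall>t\<in>{0..T}. wiener_integral P W t (K t) (B t))"

section \<open>Strong solutions\<close>

definition strong_solution ::
    "'w measure \<Rightarrow> real \<Rightarrow> (real \<Rightarrow> 'w measure) \<Rightarrow> (real \<Rightarrow> 'w \<Rightarrow> real) \<Rightarrow>
     (real \<Rightarrow> real \<Rightarrow> real) \<Rightarrow> real \<Rightarrow> (real \<Rightarrow> 'w \<Rightarrow> real) \<Rightarrow> bool" where
  "strong_solution P T A B b x0 X \<longleftrightarrow>
     adapted T A X \<and>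
     (AE \<omega> in P.
        set_integrable lebesgue {0..T} (\<lambda>s. b s (X s \<omega>)) \<and>
        (\<forall>t\<in>{0..T}. X t \<omega> = x0 + (LINT s:{0..t}|lebesgue. b s (X s \<omega>)) + B t \<omega>))"

section \<open>Lebesgue spaces on the line\<close>

text \<open>Membership of a pointwise defined function in \<open>L\<^sup>q\<close>, where \<open>q = \<infinity>\<close> is allowed.\<close>

definition in_Lq :: "ennreal \<Rightarrow> (real \<Rightarrow> real) \<Rightarrow> bool" where
  "in_Lq q f \<longleftrightarrow>
     f \<in> borel_measurable lebesgue \<and>
     (if q = \<infinity> then esssup lebesgue (\<lambda>x. ereal \<bar>f x\<bar>) < \<infinity>
      else integrable lebesgue (\<lambda>x. \<bar>f x\<bar> powr enn2real q))"

end

theory Submission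
  imports Defs
begin

text \<open>
  The drift \<open>b\<close> vanishes off the countable set \<open>S = M\<^sub>1 \<union> \<dots> \<union> M\<^sub>m\<close>. Hence, if an adapted process \<open>X\<close>
  satisfies \<open>X t \<notin> S\<close> almost surely for every \<open>t > 0\<close>, then by Fubini the drift integral along \<open>X\<close> is
  zero. This holds whenever \<open>X - B\<close> has \<open>C\<close>-Lipschitz paths: given the past up to \<open>t - \<epsilon>\<close>, the
  variable \<open>B t\<close> has a Gaussian component of standard deviation at least \<open>c \<epsilon> powr H\<close>, whereas \<open>X - B\<close>
  moves by at most \<open>C \<epsilon>\<close>, so \<open>X t\<close> hits a given point with probability of order
  \<open>\<epsilon> powr (1 - H)\<close>, for every \<open>\<epsilon>\<close>. Taking \<open>X = x0 + B\<close> gives existence. If the \<open>f\<^sub>i\<close> are bounded, then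
  every solution differs from \<open>B\<close> by a Lipschitz process and therefore equals \<open>x0 + B\<close>.
\<close>

section \<open>Gaussian smoothing and step functions\<close>

text \<open>Conditionally on \<open>F\<close> the argument is a constant plus a centred Gaussian of
  standard deviation \<open>\<bar>a\<bar> * d\<close>, and convolving two centred normal densities
  adds their variances. A Gaussian test function stays Gaussian under this smoothing, so the step
  can be iterated.\<close>

lemma (in prob_space) nn_integral_normal_density_indep_add:
  assumes F: "subalgebra M F" and Z: "Z \<in> borel_measurable F"
    and G: "distributed M lborel G (normal_density 0 d)"
    and indep: "indep_set (sets (vimage_algebra (space M) G borel)) (sets F)"
    and d: "0 < d" and s: "0 < s"
  shows "(\<integral>\<^sup>+\<omega>. normal_density 0 s (Z \<omega> + a * G \<omega>) \<partial>M) =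
         (\<integral>\<^sup>+\<omega>. normal_density 0 (sqrt (s\<^sup>2 + a\<^sup>2 * d\<^sup>2)) (Z \<omega>) \<partial>M)"
\<comment> \<open>For \<open>a = 0\<close> the law of \<open>a * G\<close> has no density, so the
  convolution formula does not apply.\<close>
proof (cases "a = 0")
  case True
  then show ?thesis using s by simp
next
  case a: False
  have GM[measurable]: "G \<in> borel_measurable M"
    using distributed_measurable[OF G] by simp
  have ZM[measurable]: "Z \<in> borel_measurable M"
    using measurable_from_subalg[OF F Z] .
  have "indep_var borel G borel Z"
    unfolding indep_var_eq indep_set_def
  proof (intro conjI)
    show "indep_sets (case_bool (sigma_sets (space M) {G -` A \<inter> space M |A. A \<in> sets borel})
        (sigma_sets (space M) {Z -` A \<inter> space M |A. A \<in> sets borel})) UNIV"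
    proof (rule indep_sets_mono_sets[OF indep[unfolded indep_set_def]])
      have "{Z -` A \<inter> space M |A. A \<in> sets borel} \<subseteq> sets F"
        using measurable_sets[OF Z] F by (auto simp: subalgebra_def)
      then have "sigma_sets (space M) {Z -` A \<inter> space M |A. A \<in> sets borel} \<subseteq> sets F"
        using sets.sigma_sets_subset[of _ F] F by (simp add: subalgebra_def)
      then show "case_bool (sigma_sets (space M) {G -` A \<inter> space M |A. A \<in> sets borel})
          (sigma_sets (space M) {Z -` A \<inter> space M |A. A \<in> sets borel}) i
        \<subseteq> case_bool (sets (vimage_algebra (space M) G borel)) (sets F) i" for i
        by (auto simp: sets_vimage_algebra split: bool.splits)
    qed
  qed auto
  then have D: "distr M borel G \<Otimes>\<^sub>M distr M borel Z = distr M (borel \<Otimes>\<^sub>M borel) (\<lambda>\<omega>. (G \<omega>, Z \<omega>))"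
    by (simp add: indep_var_distribution_eq)
  \<comment> \<open>The sign is flipped because the convolution formula evaluates the other density
    at \<open>z - y\<close>.\<close>
  have aG: "distributed M lborel (\<lambda>\<omega>. 0 + - a * G \<omega>) (normal_density (0 + - a * 0) (\<bar>- a\<bar> * d))"
    by (rule normal_density_affine[OF G d]) (use a in auto)
  interpret DG: prob_space "distr M borel G" by (rule prob_space_distr) simp
  interpret DZ: prob_space "distr M borel Z" by (rule prob_space_distr) simp
  interpret pair_prob_space "distr M borel G" "distr M borel Z" ..
  have conv: "(\<integral>\<^sup>+\<omega>. normal_density 0 s (z + a * G \<omega>) \<partial>M)
      = ennreal (normal_density 0 (sqrt (s\<^sup>2 + a\<^sup>2 * d\<^sup>2)) z)" for z
  proof -
    have "(\<integral>\<^sup>+\<omega>. normal_density 0 s (z + a * G \<omega>) \<partial>M)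
      = (\<integral>\<^sup>+\<omega>. normal_density 0 s (z - (0 + - a * G \<omega>)) \<partial>M)" by simp
    also have "\<dots> = (\<integral>\<^sup>+y. ennreal (normal_density 0 (\<bar>a\<bar> * d) y) * normal_density 0 s (z - y) \<partial>lborel)"
      using distributed_nn_integral[OF aG, of "\<lambda>y. ennreal (normal_density 0 s (z - y))"]
      by simp
    also have "\<dots> = (\<integral>\<^sup>+y. ennreal (normal_density 0 s (z - y) * normal_density 0 (\<bar>a\<bar> * d) y) \<partial>lborel)"
      by (simp add: ennreal_mult' mult.commute)
    also have "\<dots> = normal_density 0 (sqrt (s\<^sup>2 + (\<bar>a\<bar> * d)\<^sup>2)) z"
      using conv_normal_density_zero_mean[of s "\<bar>a\<bar> * d"] s d a by (auto dest: fun_cong)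
    finally show ?thesis by (simp add: power_mult_distrib)
  qed
  have "(\<integral>\<^sup>+\<omega>. normal_density 0 s (Z \<omega> + a * G \<omega>) \<partial>M)
    = (\<integral>\<^sup>+p. normal_density 0 s (snd p + a * fst p) \<partial>distr M (borel \<Otimes>\<^sub>M borel) (\<lambda>\<omega>. (G \<omega>, Z \<omega>)))"
    by (subst nn_integral_distr) auto
  also have "\<dots> = (\<integral>\<^sup>+z. \<integral>\<^sup>+g. normal_density 0 s (z + a * g) \<partial>distr M borel G \<partial>distr M borel Z)"
    unfolding D[symmetric]
    by (subst nn_integral_snd[symmetric]) (auto simp: measurable_split_conv)
  also have "\<dots> = (\<integral>\<^sup>+z. normal_density 0 (sqrt (s\<^sup>2 + a\<^sup>2 * d\<^sup>2)) z \<partial>distr M borel Z)"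
    by (intro nn_integral_cong, subst nn_integral_distr) (auto simp: conv)
  also have "\<dots> = (\<integral>\<^sup>+\<omega>. normal_density 0 (sqrt (s\<^sup>2 + a\<^sup>2 * d\<^sup>2)) (Z \<omega>) \<partial>M)"
    by (subst nn_integral_distr) auto
  finally show ?thesis .
qed

text \<open>An entry with \<open>s \<le> u \<le> v\<close> becomes the empty interval
  \<open>{s<..s}\<close>: it stays in the list but contributes nothing.\<close>

definition trunc_step :: "real \<Rightarrow> (real \<times> real \<times> real) list \<Rightarrow> (real \<times> real \<times> real) list" where
  "trunc_step s p = map (\<lambda>(a, u, v). (a, min u s, min v s)) p"

text \<open>Counting the points of this set inside an open time interval gives the measure for the
  induction on step integrals.\<close>

definition breaks :: "(real \<times> real \<times> real) list \<Rightarrow> real set" where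
  "breaks p = (\<Union>(a, u, v)\<in>set p. {u, v})"

lemma finite_breaks [simp]: "finite (breaks p)"
  by (auto simp: breaks_def)

lemma breaks_trunc_step: "breaks (trunc_step s p) = (\<lambda>x. min x s) ` breaks p"
  by (auto simp: breaks_def trunc_step_def image_iff)

lemma step_fun_trunc_step: "x \<le> s \<Longrightarrow> step_fun (trunc_step s p) x = step_fun p x"
  by (induction p) (auto simp: step_fun_def trunc_step_def indicator_def)

text \<open>Each interval \<open>{u<..v}\<close> either contains \<open>{s<..t}\<close> or misses
  it. The value is read off at \<open>t\<close> because the intervals are closed on the
  right.\<close>

lemma step_fun_const:
  assumes "breaks p \<subseteq> {..s} \<union> {t..}" "s < x" "x \<le> t"
  shows "step_fun p x = step_fun p t"
  using assms by (induction p) (auto simp: step_fun_def breaks_def indicator_def)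

text \<open>Truncation only affects intervals that end at \<open>t\<close>. Those starting at or
  before \<open>s\<close> lose the increment of \<open>W\<close> from \<open>s\<close> to
  \<open>t\<close>, and their coefficients add up to \<open>step_fun p t\<close>. The order
  \<open>u \<le> v\<close> excludes a reversed pair \<open>u = t\<close>, \<open>v \<le> s\<close>,
  which would enter the integral but not the step function.\<close>

lemma step_integral_trunc_step:
  assumes "breaks p \<subseteq> {..s} \<union> {t}" "s < t" "\<forall>(a, u, v)\<in>set p. u \<le> v"
  shows "step_integral W p \<omega> =
    step_integral W (trunc_step s p) \<omega> + step_fun p t * (W t \<omega> - W s \<omega>)"
  using assms
  by (induction p)
    (auto simp: step_integral_def step_fun_def breaks_def trunc_step_def indicator_def
       min_def algebra_simps)

lemma step_fun_measurable [measurable]: "step_fun p \<in> borel_measurable borel"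
  by (induction p) (auto simp: step_fun_def[abs_def] split_beta)

lemma step_fun_bounded: "\<bar>step_fun p x\<bar> \<le> (\<Sum>q\<leftarrow>p. \<bar>fst q\<bar>)"
proof (induction p)
  case Nil then show ?case by (simp add: step_fun_def)
next
  case (Cons q p)
  obtain a u v where q: "q = (a, u, v)" by (cases q)
  have "\<bar>step_fun (q # p) x\<bar> \<le> \<bar>a * indicator {u<..v} x\<bar> + \<bar>step_fun p x\<bar>"
    by (simp add: step_fun_def q)
  also have "\<dots> \<le> \<bar>a\<bar> + (\<Sum>q\<leftarrow>p. \<bar>fst q\<bar>)"
    by (intro add_mono Cons) (auto simp: indicator_def)
  finally show ?case by (simp add: q)
qed

lemma set_integrable_step_fun_square:
  assumes "S \<in> sets lebesgue" "S \<subseteq> {r..t}"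
  shows "set_integrable lebesgue S (\<lambda>x. (step_fun p x)\<^sup>2)"
proof (rule set_integrable_subset[of _ "{r..t}"])
  have m: "(\<lambda>x. indicator {r..t} x *\<^sub>R (step_fun p x)\<^sup>2) \<in> borel_measurable lebesgue"
    by (rule measurable_completion) measurable
  show "set_integrable lebesgue {r..t} (\<lambda>x. (step_fun p x)\<^sup>2)"
    unfolding set_integrable_def
  proof (rule integrableI_bounded_set[where A="{r..t}" and B="(\<Sum>q\<leftarrow>p. \<bar>fst q\<bar>)\<^sup>2"])
    show "AE x in lebesgue. x \<in> {r..t} \<longrightarrow> norm (indicator {r..t} x *\<^sub>R (step_fun p x)\<^sup>2) \<le> (\<Sum>q\<leftarrow>p. \<bar>fst q\<bar>)\<^sup>2"
      using step_fun_bounded[of p] by (auto intro!: AE_I2 simp: abs_le_square_iff[symmetric] intro: order_trans[OF _ abs_ge_self])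
  qed (use m in \<open>auto simp: emeasure_lborel_Icc_eq\<close>)
qed (use assms in auto)

lemma normal_density_le: "0 < s \<Longrightarrow> normal_density 0 s x \<le> 1 / sqrt (2 * pi * s\<^sup>2)"
  unfolding normal_density_def by (simp add: divide_right_mono)

section \<open>Small ball estimates for Wiener integrals\<close>

locale brownian = prob_space P
  for P :: "'w measure" +
  fixes T :: real and A :: "real \<Rightarrow> 'w measure" and W :: "real \<Rightarrow> 'w \<Rightarrow> real"
  assumes filtered: "filtered_prob_space P T A"
    and bm: "brownian_motion P T A W"
begin

lemma subalg: "0 \<le> t \<Longrightarrow> t \<le> T \<Longrightarrow> subalgebra P (A t)"
  using filtered by (auto simp: filtered_prob_space_def)

lemma subalg_mono: "0 \<le> s \<Longrightarrow> s \<le> t \<Longrightarrow> t \<le> T \<Longrightarrow> subalgebra (A t) (A s)"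
  using filtered subalg[of s] subalg[of t]
  by (auto simp: filtered_prob_space_def subalgebra_def)

lemma measurable_mono:
  "0 \<le> s \<Longrightarrow> s \<le> t \<Longrightarrow> t \<le> T \<Longrightarrow> Z \<in> borel_measurable (A s) \<Longrightarrow> Z \<in> borel_measurable (A t)"
  using measurable_from_subalg[OF subalg_mono] .

lemma measurable_P:
  "0 \<le> s \<Longrightarrow> s \<le> T \<Longrightarrow> Z \<in> borel_measurable (A s) \<Longrightarrow> Z \<in> borel_measurable P"
  using measurable_from_subalg[OF subalg] .

lemma W_measurable: "0 \<le> s \<Longrightarrow> s \<le> t \<Longrightarrow> t \<le> T \<Longrightarrow> W s \<in> borel_measurable (A t)"
  using bm by (intro measurable_mono[of s t]) (auto simp: brownian_motion_def adapted_def)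

lemma step_integral_measurable:
  assumes "t \<le> T" "\<forall>(a, u, v)\<in>set p. 0 \<le> u \<and> u \<le> v \<and> v \<le> t"
  shows "step_integral W p \<in> borel_measurable (A t)"
  using assms(2)
proof (induction p)
  case Nil
  then show ?case by (simp add: step_integral_def[abs_def])
next
  case (Cons q p)
  obtain a u v where q: "q = (a, u, v)" by (cases q)
  have [measurable]: "W u \<in> borel_measurable (A t)" "W v \<in> borel_measurable (A t)"
    using Cons.prems assms(1) by (auto simp: q intro!: W_measurable)
  have [measurable]: "step_integral W p \<in> borel_measurable (A t)"
    using Cons by auto
  have "step_integral W (q # p) = (\<lambda>\<omega>. a * (W v \<omega> - W u \<omega>) + step_integral W p \<omega>)"
    by (auto simp: step_integral_def q)
  then show ?case by simp
qed

lemma nn_integral_normal_density_increment: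
  assumes "0 \<le> r" "r < t" "t \<le> T" and Z: "Z \<in> borel_measurable (A r)" and "0 < s"
  shows "(\<integral>\<^sup>+\<omega>. normal_density 0 s (Z \<omega> + a * (W t \<omega> - W r \<omega>)) \<partial>P) =
    (\<integral>\<^sup>+\<omega>. normal_density 0 (sqrt (s\<^sup>2 + a\<^sup>2 * (t - r))) (Z \<omega>) \<partial>P)"
  using nn_integral_normal_density_indep_add[OF subalg Z, of "\<lambda>\<omega>. W t \<omega> - W r \<omega>" "sqrt (t - r)" s a]
    bm assms by (simp add: brownian_motion_def)

text \<open>
  The last increment of \<open>W\<close> in the step integral is independent of everything else, so integrating
  it out only widens the Gaussian test function. Repeating this back to time \<open>r\<close> leaves a Gaussian
  density, which is bounded by its value at \<open>0\<close>.
\<close>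

lemma nn_integral_normal_density_step_integral:
  assumes "0 \<le> r" "r \<le> t" "t \<le> T" and Z: "Z \<in> borel_measurable (A r)" and "0 < s"
    and "\<forall>(a, u, v)\<in>set p. 0 \<le> u \<and> u \<le> v \<and> v \<le> t"
  shows "(\<integral>\<^sup>+\<omega>. normal_density 0 s (Z \<omega> + step_integral W p \<omega>) \<partial>P) \<le>
    ennreal (1 / sqrt (2 * pi * (s\<^sup>2 + (LINT x:{r..t}|lebesgue. (step_fun p x)\<^sup>2))))"
  using assms(2,3,5,6)
\<comment> \<open>One step changes \<open>t\<close>, \<open>p\<close> and \<open>s\<close> together:
  the horizon moves to an earlier time, the list is truncated there, and the test function
  widens.\<close>
proof (induction "card (breaks p \<inter> {r<..<t})" arbitrary: t p s rule: less_induct)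
  case less
  \<comment> \<open>On the degenerate interval \<open>{r..r}\<close> the energy (the integral of the
    squared step function) is zero and the density is bounded by its maximum. This serves both for
    \<open>r = t\<close> and for a step that leads back to \<open>r\<close> at once.\<close>
  have base: "(\<integral>\<^sup>+\<omega>. normal_density 0 s (Z \<omega> + step_integral W p \<omega>) \<partial>P) \<le>
    ennreal (1 / sqrt (2 * pi * (s\<^sup>2 + (LINT x:{r..r}|lebesgue. (step_fun p x)\<^sup>2))))"
    if "0 < s" for p s
  proof -
    have "(LINT x:{r..r}|lebesgue. (step_fun p x)\<^sup>2) = 0"
    proof -
      have "AE x in lebesgue. x \<notin> {r}"
        by (intro AE_not_in null_sets_completionI) auto
      then show ?thesis
        unfolding set_lebesgue_integral_def by (intro integral_eq_zero_AE) auto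
    qed
    moreover have "(\<integral>\<^sup>+\<omega>. normal_density 0 s (Z \<omega> + step_integral W p \<omega>) \<partial>P)
        \<le> (\<integral>\<^sup>+\<omega>. ennreal (1 / sqrt (2 * pi * s\<^sup>2)) \<partial>P)"
      by (intro nn_integral_mono ennreal_leI normal_density_le that)
    ultimately show ?thesis by (simp add: emeasure_space_1)
  qed
  show ?case
  proof (cases "r = t")
    case True
    then show ?thesis using base less.prems by simp
  next
    case False
    then have rt: "r < t" using less.prems by simp
    \<comment> \<open>The last breakpoint strictly between \<open>r\<close> and \<open>t\<close>, or
      \<open>r\<close> if there is none; the step function is constant on
      \<open>{\<tau><..t}\<close>.\<close>
    define \<tau> where "\<tau> = Max (insert r (breaks p \<inter> {r<..<t}))"
    have fin: "finite (insert r (breaks p \<inter> {r<..<t}))" by simp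
    have \<tau>in: "\<tau> \<in> insert r (breaks p \<inter> {r<..<t})"
      unfolding \<tau>_def using fin by (intro Max_in) auto
    have \<tau>: "r \<le> \<tau>" "\<tau> < t" using \<tau>in rt by auto
    have le\<tau>: "x \<le> \<tau>" if "x \<in> breaks p" "x < t" for x
    proof (cases "r < x")
      case True
      then show ?thesis unfolding \<tau>_def using fin that by (intro Max_ge) auto
    qed (use \<tau> in auto)
    have le_t: "x \<le> t" if "x \<in> breaks p" for x
      using less.prems(4) that by (fastforce simp: breaks_def)
    have br: "breaks p \<subseteq> {..\<tau>} \<union> {t}"
      using le\<tau> le_t by (force simp: order.order_iff_strict)
    let ?p = "trunc_step \<tau> p" and ?a = "step_fun p t"
    let ?s = "sqrt (s\<^sup>2 + ?a\<^sup>2 * (t - \<tau>))"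
    have p': "\<forall>(a, u, v)\<in>set ?p. 0 \<le> u \<and> u \<le> v \<and> v \<le> \<tau>"
      using less.prems(4) \<tau> assms(1) by (fastforce simp: trunc_step_def)
    have s': "0 < ?s" using less.prems(3) \<tau> by (simp add: add_pos_nonneg)
    have m: "(\<lambda>\<omega>. Z \<omega> + step_integral W ?p \<omega>) \<in> borel_measurable (A \<tau>)"
    proof -
      have [measurable]: "step_integral W ?p \<in> borel_measurable (A \<tau>)"
        using p' \<tau> less.prems by (intro step_integral_measurable) auto
      have [measurable]: "Z \<in> borel_measurable (A \<tau>)"
        using \<tau> less.prems assms(1) Z by (intro measurable_mono[of r \<tau>]) auto
      show ?thesis by measurable
    qed
    have "(\<integral>\<^sup>+\<omega>. normal_density 0 s (Z \<omega> + step_integral W p \<omega>) \<partial>P)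
      = (\<integral>\<^sup>+\<omega>. normal_density 0 s ((Z \<omega> + step_integral W ?p \<omega>) + ?a * (W t \<omega> - W \<tau> \<omega>)) \<partial>P)"
      using less.prems(4)
      by (subst step_integral_trunc_step[OF br \<tau>(2)]) (auto simp: add.assoc)
    also have "\<dots> = (\<integral>\<^sup>+\<omega>. normal_density 0 ?s (Z \<omega> + step_integral W ?p \<omega>) \<partial>P)"
      using \<tau> less.prems assms(1) m by (intro nn_integral_normal_density_increment) auto
    also have "\<dots> \<le> ennreal (1 / sqrt (2 * pi * (?s\<^sup>2 + (LINT x:{r..\<tau>}|lebesgue. (step_fun ?p x)\<^sup>2))))"
    \<comment> \<open>With \<open>r = \<tau>\<close> there is no breakpoint in between, so the
      induction measure cannot drop and \<open>base\<close> takes over. Otherwise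
      \<open>\<tau>\<close> is itself a breakpoint that leaves the open interval.\<close>
    proof (cases "r = \<tau>")
      case True
      then show ?thesis using base[OF s', of ?p] by simp
    next
      case False
      have "breaks ?p \<inter> {r<..<\<tau>} \<subset> breaks p \<inter> {r<..<t}"
        using False \<tau>in \<tau> by (auto simp: breaks_trunc_step min_def split: if_splits)
      then have "card (breaks ?p \<inter> {r<..<\<tau>}) < card (breaks p \<inter> {r<..<t})"
        by (intro psubset_card_mono) auto
      then show ?thesis
        using \<tau> less.prems(2) s' p' by (intro less.hyps) auto
    qed
    \<comment> \<open>The variance \<open>?a\<^sup>2 * (t - \<tau>)\<close> gained by widening is
      exactly the energy of the step function on the piece that was removed.\<close>
    also have "?s\<^sup>2 + (LINT x:{r..\<tau>}|lebesgue. (step_fun ?p x)\<^sup>2)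
      = s\<^sup>2 + (LINT x:{r..t}|lebesgue. (step_fun p x)\<^sup>2)"
    proof -
      have "(LINT x:{r..t}|lebesgue. (step_fun p x)\<^sup>2)
        = (LINT x:{r..\<tau>}\<union>{\<tau><..t}|lebesgue. (step_fun p x)\<^sup>2)"
        using \<tau> by (simp add: ivl_disj_un)
      also have "\<dots> = (LINT x:{r..\<tau>}|lebesgue. (step_fun p x)\<^sup>2)
          + (LINT x:{\<tau><..t}|lebesgue. (step_fun p x)\<^sup>2)"
        using \<tau> by (intro set_integral_Un set_integrable_step_fun_square[of _ r t]) auto
      also have "(LINT x:{r..\<tau>}|lebesgue. (step_fun p x)\<^sup>2) = (LINT x:{r..\<tau>}|lebesgue. (step_fun ?p x)\<^sup>2)"
        by (intro set_lebesgue_integral_cong) (auto simp: step_fun_trunc_step)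
      also have "(LINT x:{\<tau><..t}|lebesgue. (step_fun p x)\<^sup>2) = (LINT x:{\<tau><..t}|lebesgue. ?a\<^sup>2)"
      proof (intro set_lebesgue_integral_cong)
        have "breaks p \<subseteq> {..\<tau>} \<union> {t..}" using br by auto
        then show "\<forall>x. x \<in> {\<tau><..t} \<longrightarrow> (step_fun p x)\<^sup>2 = ?a\<^sup>2"
          using step_fun_const[of p \<tau> t] by (metis greaterThanAtMost_iff)
      qed auto
      also have "\<dots> = ?a\<^sup>2 * (t - \<tau>)"
        using \<tau> by (simp add: set_lebesgue_integral_def)
      finally show ?thesis using \<tau> by (simp add: add_nonneg_nonneg)
    qed
    finally show ?thesis .
  qed
qed

text \<open>The indicator of \<open>{-s..s}\<close> is dominated by a multiple of the normal density
  with standard deviation \<open>s\<close>, whose expectation the preceding lemma bounds in terms of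
  the energy.\<close>

lemma prob_step_integral_small:
  assumes "0 \<le> r" "r \<le> t" "t \<le> T" and Z: "Z \<in> borel_measurable (A r)" and s: "0 < s"
    and p: "\<forall>(a, u, v)\<in>set p. 0 \<le> u \<and> u \<le> v \<and> v \<le> t"
    and v: "0 < v" "v \<le> (LINT x:{r..t}|lebesgue. (step_fun p x)\<^sup>2)"
  shows "prob {\<omega>\<in>space P. \<bar>Z \<omega> + step_integral W p \<omega>\<bar> \<le> s} \<le> exp 1 * s / sqrt v"
proof -
  let ?V = "\<lambda>\<omega>. Z \<omega> + step_integral W p \<omega>" and ?n = "normal_density 0 s"
  let ?I = "LINT x:{r..t}|lebesgue. (step_fun p x)\<^sup>2"
  have [measurable]: "Z \<in> borel_measurable P" "step_integral W p \<in> borel_measurable P"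
    using assms by (auto intro!: measurable_P[of r Z] measurable_P[OF _ _ step_integral_measurable[of t]])
  let ?E = "{\<omega>\<in>space P. \<bar>?V \<omega>\<bar> \<le> s}"
  \<comment> \<open>On the ball the exponent of the density is at least \<open>-1\<close>, which the
    factor \<open>exp 1\<close> compensates; the other factors cancel the normalisation.\<close>
  have ind: "indicator ?E \<omega> \<le> (exp 1 * s * sqrt (2 * pi)) * ?n (?V \<omega>)" for \<omega>
  proof (cases "\<omega> \<in> ?E")
    case True
    then have "(?V \<omega>)\<^sup>2 \<le> s\<^sup>2" by (simp add: abs_le_square_iff[symmetric] s abs_of_pos)
    then have "(?V \<omega>)\<^sup>2 / (2 * s\<^sup>2) \<le> 1" using s by (auto simp: pos_divide_le_eq intro: order_trans)
    then have "0 \<le> 1 + - (?V \<omega>)\<^sup>2 / (2 * s\<^sup>2)" by linarith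
    then have "1 \<le> exp (1 + - (?V \<omega>)\<^sup>2 / (2 * s\<^sup>2))" by (rule one_le_exp_iff[THEN iffD2])
    also have "\<dots> = (exp 1 * s * sqrt (2 * pi)) * ?n (?V \<omega>)"
      using s by (simp add: normal_density_def real_sqrt_mult exp_diff exp_minus inverse_eq_divide)
    finally show ?thesis using True by simp
  qed (use s in auto)
  have "ennreal (prob ?E) = (\<integral>\<^sup>+\<omega>. indicator ?E \<omega> \<partial>P)"
    by (simp add: emeasure_eq_measure)
  also have "\<dots> \<le> (\<integral>\<^sup>+\<omega>. ennreal (exp 1 * s * sqrt (2 * pi)) * ennreal (?n (?V \<omega>)) \<partial>P)"
    using ind s by (intro nn_integral_mono)
      (auto simp: ennreal_mult'[symmetric] simp flip: ennreal_indicator intro!: ennreal_leI)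
  also have "\<dots> = ennreal (exp 1 * s * sqrt (2 * pi)) * (\<integral>\<^sup>+\<omega>. ?n (?V \<omega>) \<partial>P)"
    by (rule nn_integral_cmult) measurable
  also have "\<dots> \<le> ennreal (exp 1 * s * sqrt (2 * pi)) * ennreal (1 / sqrt (2 * pi * (s\<^sup>2 + ?I)))"
    by (intro mult_left_mono nn_integral_normal_density_step_integral assms) auto
  also have "\<dots> = ennreal (exp 1 * s / sqrt (s\<^sup>2 + ?I))"
    using s v by (simp add: ennreal_mult'[symmetric] real_sqrt_mult)
  also have "\<dots> \<le> ennreal (exp 1 * s / sqrt v)"
    using s v by (intro ennreal_leI divide_left_mono mult_pos_pos) (auto simp: add_pos_pos intro: add_increasing)
  finally show ?thesis using s v by (simp add: ennreal_le_iff)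
qed

text \<open>Replacing \<open>I\<close> by an approximating step integral doubles the radius and
  keeps at least a quarter of the energy \<open>?v\<close>; each effect doubles the bound, hence the
  4. The Chebyshev error of the replacement vanishes in the limit.\<close>

lemma prob_wiener_integral_small:
  assumes "0 \<le> r" "r \<le> t" "t \<le> T" and Z: "Z \<in> borel_measurable (A r)" and s: "0 < s"
    and I: "wiener_integral P W t g I"
    and v: "0 < (LINT x:{r..t}|lebesgue. (g x)\<^sup>2)" (is "0 < ?v")
  shows "prob {\<omega>\<in>space P. \<bar>Z \<omega> + I \<omega>\<bar> \<le> s} \<le> 4 * exp 1 * s / sqrt ?v"
proof -
  obtain p where p: "\<And>n. \<forall>(a, u, v)\<in>set (p n). 0 \<le> u \<and> u \<le> v \<and> v \<le> t"
    and pg: "(\<lambda>n. \<integral>\<^sup>+ x\<in>{0..t}. ennreal ((g x - step_fun (p n) x)\<^sup>2) \<partial>lebesgue) \<longlonglongrightarrow> 0"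
    and pI: "(\<lambda>n. \<integral>\<^sup>+ \<omega>. ennreal ((I \<omega> - step_integral W (p n) \<omega>)\<^sup>2) \<partial>P) \<longlonglongrightarrow> 0"
    using I by (auto simp: wiener_integral_def)
  have [measurable]: "step_integral W (p n) \<in> borel_measurable P" for n
    using assms(1-3) p
    by (intro measurable_P[of t, OF _ _ step_integral_measurable[of t]]) auto
  have [measurable]: "I \<in> borel_measurable P" "Z \<in> borel_measurable P"
    using I assms(1-4) by (auto simp: wiener_integral_def intro: measurable_P[of r Z])
  have gm: "(\<lambda>x. indicator {0..t} x * g x) \<in> borel_measurable lebesgue"
    and gi: "set_integrable lebesgue {0..t} (\<lambda>x. (g x)\<^sup>2)"
    using I by (auto simp: wiener_integral_def set_borel_measurable_def)
  have hm: "step_fun q \<in> borel_measurable lebesgue" for q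
    by (rule measurable_completion) measurable
  have nn: "(\<integral>\<^sup>+ x. ennreal (indicator {r..t} x * f x) \<partial>lebesgue) = ennreal (LINT x:{r..t}|lebesgue. f x)"
    if "set_integrable lebesgue {r..t} f" "\<And>x. 0 \<le> f x" for f :: "real \<Rightarrow> real"
    using that unfolding set_lebesgue_integral_def set_integrable_def
    by (subst nn_integral_eq_integral[symmetric]) (auto simp: mult.commute)
  have gir: "set_integrable lebesgue {r..t} (\<lambda>x. (g x)\<^sup>2)"
    using set_integrable_subset[OF gi, of "{r..t}"] assms(1) by auto
  have hir: "set_integrable lebesgue {r..t} (\<lambda>x. (step_fun q x)\<^sup>2)" for q
    by (rule set_integrable_step_fun_square[of _ r t]) auto
  \<comment> \<open>By \<open>(g x)\<^sup>2 \<le> 2 * (g x - ?h x)\<^sup>2 + 2 * (?h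
    x)\<^sup>2\<close>, an approximation error below \<open>?v / 4\<close> accounts for at most half
    of \<open>?v\<close>.\<close>
  have step_ge: "\<forall>\<^sub>F n in sequentially. ?v / 4 \<le> (LINT x:{r..t}|lebesgue. (step_fun (p n) x)\<^sup>2)"
  proof -
    have "\<forall>\<^sub>F n in sequentially. (\<integral>\<^sup>+ x\<in>{0..t}. ennreal ((g x - step_fun (p n) x)\<^sup>2) \<partial>lebesgue) < ennreal (?v / 4)"
      using v by (intro order_tendstoD(2)[OF pg]) simp
    then show ?thesis
    proof eventually_elim
      case (elim n)
      let ?h = "step_fun (p n)"
      \<comment> \<open>\<open>g\<close> is only known to be measurable on \<open>{0..t}\<close>, so
        the indicator is moved onto it before squaring.\<close>
      have dm: "(\<lambda>x. ennreal ((g x - ?h x)\<^sup>2) * indicator {0..t} x) \<in> borel_measurable lebesgue"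
      proof -
        have "(\<lambda>x. ennreal ((g x - ?h x)\<^sup>2) * indicator {0..t} x)
          = (\<lambda>x. ennreal ((indicator {0..t} x * g x - indicator {0..t} x * ?h x)\<^sup>2))"
          by (auto simp: indicator_def)
        also have "\<dots> \<in> borel_measurable lebesgue"
          by (intro measurable_compose[OF _ measurable_ennreal] borel_measurable_power borel_measurable_diff
              borel_measurable_times gm hm borel_measurable_indicator) auto
        finally show ?thesis .
      qed
      have hm2: "(\<lambda>x. ennreal (indicator {r..t} x * (?h x)\<^sup>2)) \<in> borel_measurable lebesgue"
        by (intro measurable_compose[OF _ measurable_ennreal] borel_measurable_power borel_measurable_diff
              borel_measurable_times gm hm borel_measurable_indicator) auto
      have "ennreal ?v = (\<integral>\<^sup>+ x. ennreal (indicator {r..t} x * (g x)\<^sup>2) \<partial>lebesgue)"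
        by (subst nn[OF gir]) auto
      also have "\<dots> \<le> (\<integral>\<^sup>+ x. 2 * (ennreal ((g x - ?h x)\<^sup>2) * indicator {0..t} x)
          + 2 * ennreal (indicator {r..t} x * (?h x)\<^sup>2) \<partial>lebesgue)"
      proof (intro nn_integral_mono)
        fix x
        have "(g x)\<^sup>2 \<le> 2 * (g x - ?h x)\<^sup>2 + 2 * (?h x)\<^sup>2"
          using zero_le_power2[of "g x - 2 * ?h x"] by (simp add: power2_eq_square algebra_simps)
        then have "ennreal ((g x)\<^sup>2) \<le> 2 * ennreal ((g x - ?h x)\<^sup>2) + 2 * ennreal ((?h x)\<^sup>2)"
          by (simp add: ennreal_mult'[symmetric] flip: ennreal_numeral ennreal_plus)
        then show "ennreal (indicator {r..t} x * (g x)\<^sup>2) \<le> 2 * (ennreal ((g x - ?h x)\<^sup>2) * indicator {0..t} x)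
          + 2 * ennreal (indicator {r..t} x * (?h x)\<^sup>2)"
          using assms(1) by (auto simp: indicator_def)
      qed
      also have "\<dots> = 2 * (\<integral>\<^sup>+ x\<in>{0..t}. ennreal ((g x - ?h x)\<^sup>2) \<partial>lebesgue)
          + 2 * (\<integral>\<^sup>+ x. ennreal (indicator {r..t} x * (?h x)\<^sup>2) \<partial>lebesgue)"
        using dm hm2 by (simp add: nn_integral_add nn_integral_cmult)
      also have "\<dots> \<le> 2 * ennreal (?v / 4) + 2 * ennreal (LINT x:{r..t}|lebesgue. (?h x)\<^sup>2)"
        using elim by (intro add_mono mult_left_mono) (auto simp: nn[OF hir])
      also have "\<dots> = ennreal (?v / 2 + 2 * (LINT x:{r..t}|lebesgue. (?h x)\<^sup>2))"
        using v by (simp add: ennreal_mult'[symmetric] set_lebesgue_integral_def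
            flip: ennreal_numeral ennreal_plus)
      finally show ?case
        using v by (subst (asm) ennreal_le_iff) (auto simp: set_lebesgue_integral_def)
    qed
  qed
  let ?E = "{\<omega>\<in>space P. \<bar>Z \<omega> + I \<omega>\<bar> \<le> s}"
  let ?c = "4 * exp 1 * s / sqrt ?v"
  let ?d = "\<lambda>n. \<integral>\<^sup>+ \<omega>. ennreal ((I \<omega> - step_integral W (p n) \<omega>)\<^sup>2) \<partial>P"
  have "(\<lambda>n. ennreal ?c + ennreal (1 / s\<^sup>2) * ?d n) \<longlonglongrightarrow> ennreal ?c + ennreal (1 / s\<^sup>2) * 0"
    by (intro tendsto_intros ennreal_tendsto_cmult pI) auto
  moreover have "\<forall>\<^sub>F n in sequentially. ennreal (prob ?E) \<le> ennreal ?c + ennreal (1 / s\<^sup>2) * ?d n"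
    using step_ge
  proof eventually_elim
    case (elim n)
    let ?I = "step_integral W (p n)"
    let ?E1 = "{\<omega>\<in>space P. \<bar>Z \<omega> + ?I \<omega>\<bar> \<le> 2 * s}"
    let ?E2 = "{\<omega>\<in>space P. 1 \<le> ennreal (1 / s\<^sup>2) * ennreal ((I \<omega> - ?I \<omega>)\<^sup>2)}"
    have "?E \<subseteq> ?E1 \<union> ?E2"
    proof
      fix \<omega> assume \<omega>: "\<omega> \<in> ?E"
      show "\<omega> \<in> ?E1 \<union> ?E2"
      proof (cases "\<bar>I \<omega> - ?I \<omega>\<bar> \<le> s")
        case True
        then show ?thesis using \<omega> by auto
      next
        case False
        then have "s\<^sup>2 \<le> (I \<omega> - ?I \<omega>)\<^sup>2"
          using s abs_le_square_iff[of s "I \<omega> - ?I \<omega>"] by auto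
        then have "1 \<le> 1 / s\<^sup>2 * (I \<omega> - ?I \<omega>)\<^sup>2" using s by (simp add: pos_le_divide_eq)
        then have "ennreal 1 \<le> ennreal (1 / s\<^sup>2 * (I \<omega> - ?I \<omega>)\<^sup>2)" by (rule ennreal_leI)
        then show ?thesis using \<omega> by (simp add: ennreal_mult'[symmetric])
      qed
    qed
    then have "ennreal (prob ?E) \<le> emeasure P (?E1 \<union> ?E2)"
      unfolding emeasure_eq_measure[symmetric] by (intro emeasure_mono) measurable
    also have "\<dots> \<le> emeasure P ?E1 + emeasure P ?E2"
      by (intro emeasure_subadditive) measurable
    also have "emeasure P ?E1 \<le> ennreal ?c"
    proof -
      have "prob ?E1 \<le> exp 1 * (2 * s) / sqrt (?v / 4)"
        using elim v s assms p by (intro prob_step_integral_small[where r=r and t=t]) auto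
      also have "\<dots> = ?c"
        by (simp add: real_sqrt_divide)
      finally show ?thesis by (simp add: emeasure_eq_measure ennreal_leI)
    qed
    also have "emeasure P ?E2 \<le> ennreal (1 / s\<^sup>2) * (\<integral>\<^sup>+ \<omega>. ennreal ((I \<omega> - ?I \<omega>)\<^sup>2) * indicator (space P) \<omega> \<partial>P)"
      by (rule nn_integral_Markov_inequality) measurable
    also have "(\<integral>\<^sup>+ \<omega>. ennreal ((I \<omega> - ?I \<omega>)\<^sup>2) * indicator (space P) \<omega> \<partial>P) = ?d n"
      by (intro nn_integral_cong) auto
    finally show ?case by (simp add: add_mono)
  qed
  ultimately have "ennreal (prob ?E) \<le> ennreal ?c + ennreal (1 / s\<^sup>2) * 0"
    by (intro tendsto_lowerbound[where F=sequentially]) auto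
  then show ?thesis using s v by (simp add: ennreal_le_iff)
qed

text \<open>An \<open>L\<^sup>2\<close> limit is the almost sure limit of a subsequence of step
  integrals, all measurable with respect to \<open>A t\<close>. The exceptional null set does no
  harm because \<open>A 0\<close> contains every null set of \<open>P\<close>.\<close>

lemma wiener_integral_measurable:
  assumes "0 \<le> t" "t \<le> T" and null: "null_sets P \<subseteq> sets (A 0)"
    and I: "wiener_integral P W t g I"
  shows "I \<in> borel_measurable (A t)"
proof -
  obtain p where p: "\<And>n. \<forall>(a, u, v)\<in>set (p n). 0 \<le> u \<and> u \<le> v \<and> v \<le> t"
    and pI: "(\<lambda>n. \<integral>\<^sup>+ \<omega>. ennreal ((I \<omega> - step_integral W (p n) \<omega>)\<^sup>2) \<partial>P) \<longlonglongrightarrow> 0"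
    using I by (auto simp: wiener_integral_def)
  have mA[measurable]: "step_integral W (p n) \<in> borel_measurable (A t)" for n
    using assms p by (intro step_integral_measurable) auto
  have [measurable]: "I \<in> borel_measurable P" "step_integral W (p n) \<in> borel_measurable P" for n
    using I assms by (auto simp: wiener_integral_def intro!: measurable_P[of t] mA)
  let ?u = "\<lambda>n \<omega>. (I \<omega> - step_integral W (p n) \<omega>)\<^sup>2"
  have "\<forall>\<^sub>F n in sequentially. (\<integral>\<^sup>+ \<omega>. ennreal (?u n \<omega>) \<partial>P) < 1"
    by (intro order_tendstoD(2)[OF pI]) simp
  \<comment> \<open>A finite \<open>L\<^sup>2\<close> distance is known only for large
    \<open>n\<close>; shifting by \<open>N\<close> makes every term integrable, as the subsequence
    theorem requires.\<close>
  then obtain N where N: "\<And>n. n \<ge> N \<Longrightarrow> (\<integral>\<^sup>+ \<omega>. ennreal (?u n \<omega>) \<partial>P) < 1"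
    by (auto simp: eventually_sequentially)
  have int: "integrable P (?u (n + N))" for n
    using N[of "n + N"] by (intro integrableI_bounded) (auto intro: less_trans)
  have "(\<lambda>n. \<integral>\<omega>. norm (?u (n + N) \<omega>) \<partial>P) \<longlonglongrightarrow> 0"
  proof -
    have "(\<lambda>n. \<integral>\<^sup>+ \<omega>. ennreal (?u (n + N) \<omega>) \<partial>P) \<longlonglongrightarrow> ennreal 0"
      using LIMSEQ_ignore_initial_segment[OF pI, of N] by simp
    then have "(\<lambda>n. ennreal (\<integral>\<omega>. ?u (n + N) \<omega> \<partial>P)) \<longlonglongrightarrow> ennreal 0"
      using int by (subst (asm) nn_integral_eq_integral) auto
    then show ?thesis by (subst (asm) tendsto_ennreal_iff) auto
  qed
  from tendsto_L1_AE_subseq[OF int this] obtain \<rho> where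
    \<rho>: "AE \<omega> in P. (\<lambda>n. ?u (\<rho> n + N) \<omega>) \<longlonglongrightarrow> 0" by auto
  \<comment> \<open>\<open>lim\<close> is total, so \<open>J\<close> is measurable on the whole
    space even if the sequence diverges somewhere.\<close>
  define J where "J \<omega> = lim (\<lambda>n. step_integral W (p (\<rho> n + N)) \<omega>)" for \<omega>
  have J[measurable]: "J \<in> borel_measurable (A t)"
    unfolding J_def by measurable
  then have [measurable]: "J \<in> borel_measurable P" using assms by (intro measurable_P[of t]) auto
  have IJ: "AE \<omega> in P. I \<omega> = J \<omega>"
    using \<rho>
  proof eventually_elim
    case (elim \<omega>)
    then have "(\<lambda>n. sqrt (?u (\<rho> n + N) \<omega>)) \<longlonglongrightarrow> sqrt 0" by (intro tendsto_intros)
    then have "(\<lambda>n. \<bar>I \<omega> - step_integral W (p (\<rho> n + N)) \<omega>\<bar>) \<longlonglongrightarrow> 0" by simp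
    then have "(\<lambda>n. I \<omega> - (I \<omega> - step_integral W (p (\<rho> n + N)) \<omega>)) \<longlonglongrightarrow> I \<omega> - 0"
      by (intro tendsto_intros) (simp add: tendsto_rabs_zero_iff)
    then show ?case unfolding J_def by (intro limI[symmetric]) simp
  qed
  have sp: "space (A t) = space P" and nul: "null_sets P \<subseteq> sets (A t)"
    using subalg[of t] subalg_mono[of 0 t] assms by (auto simp: subalgebra_def)
  show ?thesis
  proof (rule measurableI)
    fix S :: "real set" assume S[measurable]: "S \<in> sets borel"
    let ?D = "{\<omega>\<in>space P. (I \<omega> \<in> S) \<noteq> (J \<omega> \<in> S)}"
    let ?D1 = "{\<omega>\<in>space P. I \<omega> \<in> S \<and> J \<omega> \<notin> S}" and ?D2 = "{\<omega>\<in>space P. I \<omega> \<notin> S \<and> J \<omega> \<in> S}"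
    have "?D1 \<in> sets (A t)" "?D2 \<in> sets (A t)"
    proof -
      have "?D1 \<in> null_sets P" "?D2 \<in> null_sets P"
        using IJ by (auto simp: AE_iff_null_sets[symmetric] null_sets_def
            intro!: emeasure_eq_0_AE elim!: eventually_mono)
      then show "?D1 \<in> sets (A t)" "?D2 \<in> sets (A t)" using nul by auto
    qed
    moreover have "J -` S \<inter> space (A t) \<in> sets (A t)" by measurable
    moreover have "I -` S \<inter> space (A t) = ((J -` S \<inter> space (A t)) - ?D2) \<union> ?D1"
      by (auto simp: sp)
    ultimately show "I -` S \<inter> space (A t) \<in> sets (A t)" by simp
  qed simp
qed

text \<open>Freezing the Lipschitz part at time \<open>t - \<epsilon>\<close> makes it measurable
  with respect to the past, up to an error of order \<open>\<epsilon>\<close>. The small ball bound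
  is then of order \<open>\<epsilon> / \<epsilon> powr H\<close>, which tends to 0 because
  \<open>H < 1\<close>.\<close>

lemma AE_neq_of_lipschitz_drift:
  assumes "0 < t" "t \<le> T" "H < 1" "0 < c"
    and I: "wiener_integral P W t g (B t)"
    and g: "\<And>\<epsilon>. 0 < \<epsilon> \<Longrightarrow> \<epsilon> < t \<Longrightarrow> c * \<epsilon> powr H \<le> sqrt (LINT s:{t - \<epsilon>..t}|lebesgue. (g s)\<^sup>2)"
    and X: "\<And>r. 0 \<le> r \<Longrightarrow> r \<le> t \<Longrightarrow> X r \<in> borel_measurable (A r)"
    and B: "\<And>r. 0 \<le> r \<Longrightarrow> r \<le> t \<Longrightarrow> B r \<in> borel_measurable (A r)"
    and lip: "AE \<omega> in P. \<forall>r\<in>{0..t}. \<bar>(X t \<omega> - B t \<omega>) - (X r \<omega> - B r \<omega>)\<bar> \<le> C * (t - r)"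
  shows "AE \<omega> in P. X t \<omega> \<noteq> y"
proof -
  \<comment> \<open>The maximum keeps the radius \<open>D * \<epsilon>\<close> positive also for
    \<open>C = 0\<close>, the case used for existence.\<close>
  define D where "D = max C 1"
  have XP[measurable]: "X t \<in> borel_measurable P"
    using X[of t] assms(1,2) by (intro measurable_P[of t]) auto
  have BP[measurable]: "B t \<in> borel_measurable P"
    using B[of t] assms(1,2) by (intro measurable_P[of t]) auto
  let ?E = "{\<omega>\<in>space P. X t \<omega> = y}"
  have bound: "prob ?E \<le> 4 * exp 1 * D / c * \<epsilon> powr (1 - H)" if \<epsilon>: "0 < \<epsilon>" "\<epsilon> < t" for \<epsilon>
  proof -
    \<comment> \<open>If \<open>X t \<omega> = y\<close>, then
      \<open>Z \<omega> + B t \<omega>\<close> is minus the increment of \<open>X - B\<close> from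
      \<open>t - \<epsilon>\<close> to \<open>t\<close>.\<close>
    define Z where "Z \<omega> = X (t - \<epsilon>) \<omega> - B (t - \<epsilon>) \<omega> - y" for \<omega>
    let ?v = "LINT s:{t - \<epsilon>..t}|lebesgue. (g s)\<^sup>2"
    have Z: "Z \<in> borel_measurable (A (t - \<epsilon>))"
      unfolding Z_def using \<epsilon> by (intro borel_measurable_diff X B) auto
    have [measurable]: "Z \<in> borel_measurable P"
      using Z \<epsilon> assms(2) by (intro measurable_P[of "t - \<epsilon>"]) auto
    have pos: "0 < c * \<epsilon> powr H" using \<epsilon> assms(4) by simp
    then have v: "0 < ?v" using g[OF \<epsilon>] by (metis less_le_trans real_sqrt_gt_0_iff)
    have D: "0 < D * \<epsilon>" using \<epsilon> by (simp add: D_def)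
    have "prob ?E \<le> prob {\<omega>\<in>space P. \<bar>Z \<omega> + B t \<omega>\<bar> \<le> D * \<epsilon>}"
    proof (rule finite_measure_mono_AE)
      show "AE \<omega> in P. \<omega> \<in> ?E \<longrightarrow> \<omega> \<in> {\<omega>\<in>space P. \<bar>Z \<omega> + B t \<omega>\<bar> \<le> D * \<epsilon>}"
        using lip
      proof eventually_elim
        case (elim \<omega>)
        from bspec[OF elim, of "t - \<epsilon>"]
        have "\<bar>(X t \<omega> - B t \<omega>) - (X (t - \<epsilon>) \<omega> - B (t - \<epsilon>) \<omega>)\<bar> \<le> C * \<epsilon>" using \<epsilon> by simp
        also have "\<dots> \<le> D * \<epsilon>" using \<epsilon> by (simp add: D_def)
        finally show ?case by (auto simp: Z_def)
      qed
    qed measurable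
    also have "\<dots> \<le> 4 * exp 1 * (D * \<epsilon>) / sqrt ?v"
      using \<epsilon> assms(1,2) by (intro prob_wiener_integral_small[OF _ _ _ Z D I v]) auto
    also have "\<dots> \<le> 4 * exp 1 * (D * \<epsilon>) / (c * \<epsilon> powr H)"
      using g[OF \<epsilon>] pos D v \<epsilon> assms(4) by (intro divide_left_mono mult_pos_pos) auto
    also have "\<dots> = 4 * exp 1 * D / c * \<epsilon> powr (1 - H)"
      using \<epsilon> by (simp add: powr_diff)
    finally show ?thesis .
  qed
  have "((\<lambda>\<epsilon>. \<epsilon> powr (1 - H)) \<longlongrightarrow> 0) (at_right (0::real))"
    by (rule tendsto_zero_powrI[where b="1 - H"])
      (use assms(3) in \<open>auto simp: eventually_at_filter intro!: tendsto_intros\<close>)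
  then have "((\<lambda>\<epsilon>. 4 * exp 1 * D / c * \<epsilon> powr (1 - H)) \<longlongrightarrow> 4 * exp 1 * D / c * 0) (at_right (0::real))"
    by (intro tendsto_intros)
  then have "prob ?E \<le> 4 * exp 1 * D / c * 0"
  proof (rule tendsto_lowerbound)
    show "\<forall>\<^sub>F \<epsilon> in at_right 0. prob ?E \<le> 4 * exp 1 * D / c * \<epsilon> powr (1 - H)"
      using bound assms(1) by (auto simp: eventually_at_right_field intro!: exI[of _ t])
  qed simp
  then have "prob ?E = 0" by (simp add: measure_le_0_iff)
  then show ?thesis by (subst AE_iff_measurable[where N="?E"]) (auto simp: emeasure_eq_measure)
qed

end

section \<open>Fubini and the drift integral\<close>

lemma set_integral_lipschitz:
  fixes f :: "real \<Rightarrow> real"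
  assumes f: "set_integrable lebesgue {0..T} f"
    and bound: "\<And>x. x \<in> {0..T} \<Longrightarrow> \<bar>f x\<bar> \<le> C"
    and rt: "0 \<le> r" "r \<le> t" "t \<le> T"
  shows "\<bar>(LINT x:{0..t}|lebesgue. f x) - (LINT x:{0..r}|lebesgue. f x)\<bar> \<le> C * (t - r)"
proof -
  have i: "set_integrable lebesgue S f" if "S \<in> sets lebesgue" "S \<subseteq> {0..T}" for S
    using set_integrable_subset[OF f] that by auto
  have "{0..t} = {0..r} \<union> {r<..t}" using rt by auto
  then have "(LINT x:{0..t}|lebesgue. f x) = (LINT x:{0..r}\<union>{r<..t}|lebesgue. f x)" by simp
  also have "\<dots> = (LINT x:{0..r}|lebesgue. f x) + (LINT x:{r<..t}|lebesgue. f x)"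
    using rt by (intro set_integral_Un i) auto
  finally have "\<bar>(LINT x:{0..t}|lebesgue. f x) - (LINT x:{0..r}|lebesgue. f x)\<bar>
      = \<bar>LINT x:{r<..t}|lebesgue. f x\<bar>" by simp
  also have "\<dots> \<le> (LINT x:{r<..t}|lebesgue. \<bar>f x\<bar>)"
    using set_integral_norm_bound[OF i, of "{r<..t}"] rt by (simp add: subset_eq)
  also have "\<dots> \<le> (LINT x:{r<..t}|lebesgue. C)"
  proof (rule set_integral_mono)
    show "set_integrable lebesgue {r<..t} (\<lambda>x. \<bar>f x\<bar>)"
      using rt by (intro set_integrable_abs i) auto
    show "set_integrable lebesgue {r<..t} (\<lambda>x. C)"
      using rt by (simp add: set_integrable_def)
  qed (use rt bound in auto)
  also have "\<dots> = C * (t - r)"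
    using rt by (simp add: set_lebesgue_integral_def)
  finally show ?thesis .
qed

section \<open>Avoidance of a countable set at almost every time\<close>

context brownian
begin

text \<open>
  \<open>X\<close> itself need not be jointly measurable. Since \<open>X - B\<close> has Lipschitz paths, discretising it in
  time yields a jointly measurable process that almost surely agrees with \<open>X\<close> at all times, and
  Fubini applies to that process.
\<close>

lemma AE_AE_notin_countable:
  assumes "0 < T" and S: "countable S"
    and B: "(\<lambda>(t, \<omega>). B t \<omega>) \<in> borel_measurable (restrict_space borel {0..T} \<Otimes>\<^sub>M P)"
    and X: "\<And>t. t \<in> {0..T} \<Longrightarrow> X t \<in> borel_measurable P"
    and lip: "AE \<omega> in P. \<forall>r t. 0 \<le> r \<longrightarrow> r \<le> t \<longrightarrow> t \<le> T \<longrightarrow>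
        \<bar>(X t \<omega> - B t \<omega>) - (X r \<omega> - B r \<omega>)\<bar> \<le> C * (t - r)"
    and neq: "\<And>t y. 0 < t \<Longrightarrow> t \<le> T \<Longrightarrow> y \<in> S \<Longrightarrow> AE \<omega> in P. X t \<omega> \<noteq> y"
  shows "AE \<omega> in P. AE t in lebesgue. t \<in> {0..T} \<longrightarrow> X t \<omega> \<notin> S"
proof -
  \<comment> \<open>The joint measurability of \<open>B\<close> refers to Borel sets in time, so
    Fubini is applied to \<open>lborel\<close>; the result passes to the completion at the
    end.\<close>
  let ?R = "restrict_space lborel {0..T}"
  interpret R: sigma_finite_measure ?R
    by (rule sigma_finite_measure_restrict_space[OF lborel.sigma_finite_measure_axioms]) simp
  interpret pair_sigma_finite ?R P ..
  have sets_R: "sets ?R = sets (restrict_space borel {0..T})"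
    by (simp add: sets_restrict_space)
  have BR[measurable]: "(\<lambda>(t, \<omega>). B t \<omega>) \<in> borel_measurable (?R \<Otimes>\<^sub>M P)"
    using B measurable_cong_sets[OF sets_pair_measure_cong[OF sets_R refl] refl] by blast
  have Bt: "B t \<in> borel_measurable P" if "t \<in> {0..T}" for t
    using measurable_compose_Pair1[of t ?R "\<lambda>(t, \<omega>). B t \<omega>" P borel] that BR
    by (simp add: space_restrict_space)
  define D where "D t \<omega> = X t \<omega> - B t \<omega>" for t \<omega>
  \<comment> \<open>Grid points \<open>i / (n + 1)\<close> clamped to \<open>{0..T}\<close>. With
    \<open>i = \<kappa> n t\<close> this is the last grid point not after \<open>t\<close>, at
    distance at most \<open>1 / (n + 1)\<close>.\<close>
  define \<theta> where "\<theta> n i = max 0 (min T (of_int i / real (Suc n)))" for n :: nat and i :: int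
  define \<kappa> where "\<kappa> n t = \<lfloor>t * real (Suc n)\<rfloor>" for n and t :: real
  define Y where "Y t \<omega> = lim (\<lambda>n. D (\<theta> n (\<kappa> n t)) \<omega>) + B t \<omega>" for t \<omega>
  have D\<theta>[measurable]: "D (\<theta> n i) \<in> borel_measurable P" for n i
    unfolding D_def using assms(1)
    by (intro borel_measurable_diff X Bt) (auto simp: \<theta>_def)
  have Ym: "(\<lambda>p. Y (fst p) (snd p)) \<in> borel_measurable (?R \<Otimes>\<^sub>M P)"
  proof -
    have "(\<lambda>p. D (\<theta> n (\<kappa> n (fst p))) (snd p)) \<in> borel_measurable (?R \<Otimes>\<^sub>M P)" for n
    proof (rule measurable_compose_countable[where f="\<lambda>i p. D (\<theta> n i) (snd p)"])
      have "(\<lambda>t. t) \<in> borel_measurable ?R"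
        by (rule measurable_restrict_space1) simp
      then have [measurable]: "fst \<in> borel_measurable (?R \<Otimes>\<^sub>M P)"
        using measurable_compose[OF measurable_fst] by blast
      show "(\<lambda>p. \<kappa> n (fst p)) \<in> measurable (?R \<Otimes>\<^sub>M P) (count_space UNIV)"
        unfolding \<kappa>_def by measurable
    qed measurable
    moreover have "(\<lambda>p. B (fst p) (snd p)) \<in> borel_measurable (?R \<Otimes>\<^sub>M P)"
      using BR by (simp add: split_beta')
    ultimately show ?thesis
      unfolding Y_def by (intro borel_measurable_add borel_measurable_lim_metric)
  qed
  have YX: "AE \<omega> in P. \<forall>t\<in>{0..T}. Y t \<omega> = X t \<omega>"
    using lip
  proof eventually_elim
    case (elim \<omega>)
    show ?case
    proof
      fix t assume t: "t \<in> {0..T}"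
      have \<theta>t: "0 \<le> \<theta> n (\<kappa> n t)" "\<theta> n (\<kappa> n t) \<le> t" "t - \<theta> n (\<kappa> n t) \<le> 1 / real (Suc n)" for n
      proof -
        have "real_of_int (\<kappa> n t) \<le> t * real (Suc n)" "t * real (Suc n) < real_of_int (\<kappa> n t) + 1"
          unfolding \<kappa>_def by linarith+
        then have "real_of_int (\<kappa> n t) / real (Suc n) \<le> t"
          "t \<le> (real_of_int (\<kappa> n t) + 1) / real (Suc n)"
          by (simp_all only: pos_divide_le_eq pos_le_divide_eq of_nat_0_less_iff zero_less_Suc less_imp_le)
        then have "real_of_int (\<kappa> n t) / real (Suc n) \<le> t"
          "t - real_of_int (\<kappa> n t) / real (Suc n) \<le> 1 / real (Suc n)"
          by (simp_all only: add_divide_distrib)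
        moreover have "0 \<le> real_of_int (\<kappa> n t) / real (Suc n)"
          using t by (simp add: \<kappa>_def)
        ultimately show "0 \<le> \<theta> n (\<kappa> n t)" "\<theta> n (\<kappa> n t) \<le> t" "t - \<theta> n (\<kappa> n t) \<le> 1 / real (Suc n)"
          using t by (auto simp: \<theta>_def)
      qed
      have "(\<lambda>n. D (\<theta> n (\<kappa> n t)) \<omega>) \<longlonglongrightarrow> D t \<omega>"
      proof (rule Lim_transform2[OF tendsto_const], rule Lim_null_comparison)
        show "\<forall>\<^sub>F n in sequentially. norm (D t \<omega> - D (\<theta> n (\<kappa> n t)) \<omega>) \<le> \<bar>C\<bar> * (1 / real (Suc n))"
        proof (intro always_eventually allI)
          fix n
          have "norm (D t \<omega> - D (\<theta> n (\<kappa> n t)) \<omega>) \<le> C * (t - \<theta> n (\<kappa> n t))"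
            using elim \<theta>t t by (auto simp: D_def)
          also have "\<dots> \<le> \<bar>C\<bar> * (1 / real (Suc n))"
            using \<theta>t[of n] by (intro mult_mono) auto
          finally show "norm (D t \<omega> - D (\<theta> n (\<kappa> n t)) \<omega>) \<le> \<bar>C\<bar> * (1 / real (Suc n))" .
        qed
        show "(\<lambda>n. \<bar>C\<bar> * (1 / real (Suc n))) \<longlonglongrightarrow> 0"
          using tendsto_mult[OF tendsto_const LIMSEQ_inverse_real_of_nat, of "\<bar>C\<bar>"]
          by (simp add: inverse_eq_divide)
      qed
      then show "Y t \<omega> = X t \<omega>" by (simp add: Y_def D_def limI)
    qed
  qed
  have "AE t in ?R. AE \<omega> in P. Y t \<omega> \<notin> S"
  proof -
    \<comment> \<open>Time 0 is discarded as a null set, since \<open>neq\<close> speaks of positive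
      times only: a process may start at a point of \<open>S\<close>.\<close>
    have "AE t in lborel. t \<noteq> (0::real)" by (rule AE_lborel_singleton)
    then have "AE t in lborel. t \<in> {0..T} \<longrightarrow> (AE \<omega> in P. Y t \<omega> \<notin> S)"
    proof eventually_elim
      case (elim t)
      show ?case
      proof
        assume t: "t \<in> {0..T}"
        then have "AE \<omega> in P. \<forall>y\<in>S. X t \<omega> \<noteq> y"
          using elim neq[of t] by (intro AE_ball_countable' S) auto
        with YX show "AE \<omega> in P. Y t \<omega> \<notin> S"
          by eventually_elim (use t in auto)
      qed
    qed
    then show ?thesis by (subst AE_restrict_space_iff) auto
  qed
  \<comment> \<open>Exchanging the two quantifiers needs this joint measurability, the reason for
    passing from \<open>X\<close> to \<open>Y\<close>.\<close>
  moreover have "{p \<in> space (?R \<Otimes>\<^sub>M P). Y (fst p) (snd p) \<notin> S} \<in> sets (?R \<Otimes>\<^sub>M P)"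
  proof -
    have "S \<in> sets borel" using S by (rule sets.countable[rotated]) simp
    then show ?thesis using Ym by measurable
  qed
  ultimately have "AE \<omega> in P. AE t in ?R. Y t \<omega> \<notin> S"
    by (subst (asm) AE_commute)
  with YX show ?thesis
  proof eventually_elim
    case (elim \<omega>)
    from elim(2) have "AE t in lborel. t \<in> {0..T} \<longrightarrow> Y t \<omega> \<notin> S"
      by (subst (asm) AE_restrict_space_iff) auto
    then show ?case
      using elim(1) by (intro AE_completion) (auto elim!: eventually_mono)
  qed
qed

end

text \<open>\<open>f\<close> is not assumed measurable: agreeing almost everywhere with zero makes
  it so, because Lebesgue measure is complete. This supplies the integrability demanded of a
  solution.\<close>

lemma set_integral_vanishing_AE:
  fixes f :: "real \<Rightarrow> real"
  assumes "AE s in lebesgue. s \<in> {0..T} \<longrightarrow> f s = 0"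
  shows "set_integrable lebesgue {0..T} f" and "t \<in> {0..T} \<Longrightarrow> (LINT s:{0..t}|lebesgue. f s) = 0"
proof -
  have z: "AE s in lebesgue. indicator {0..t} s *\<^sub>R f s = 0" if "t \<le> T" for t
    using assms by eventually_elim (use that in \<open>auto simp: indicator_def\<close>)
  have "(\<lambda>s. indicator {0..T} s *\<^sub>R f s) \<in> borel_measurable lebesgue"
    by (rule borel_measurable_AE[of "\<lambda>_. 0"]) (use z[of T] in \<open>auto elim: eventually_mono\<close>)
  then show "set_integrable lebesgue {0..T} f"
    unfolding set_integrable_def
    by (intro integrable_cong_AE_imp[OF integrable_zero]) (use z[of T] in \<open>auto elim: eventually_mono\<close>)
  show "(LINT s:{0..t}|lebesgue. f s) = 0" if "t \<in> {0..T}"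
    unfolding set_lebesgue_integral_def using z[of t] that by (intro integral_eq_zero_AE) auto
qed

section \<open>Existence of a strong solution, and uniqueness for bounded \<open>f\<close>\<close>

theorem theorem1p3:
  fixes P :: "'w measure" and A :: "real \<Rightarrow> 'w measure"
    and W B :: "real \<Rightarrow> 'w \<Rightarrow> real"
    and K b :: "real \<Rightarrow> real \<Rightarrow> real"
    and T H c x0 :: real
    and m :: nat and M :: "nat \<Rightarrow> real set" and f :: "nat \<Rightarrow> real \<Rightarrow> real" and q :: "nat \<Rightarrow> ennreal"
  assumes "0 < T"
    and "filtered_prob_space P T A"
    and "brownian_motion P T A W"
    and "\<And>t. t \<in> {0..T} \<Longrightarrow> A t = augmented_filtration P W t"
    and "usual_conditions P T A"
    and "L2_kernel T K"
    and "volterra_process P T W K B"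
    and "0 < H" and "H < 1" and "0 < c"
    and "\<And>t \<epsilon>. 0 < t \<Longrightarrow> t \<le> T \<Longrightarrow> 0 < \<epsilon> \<Longrightarrow> \<epsilon> < t \<Longrightarrow>
           sqrt (LINT s:{t - \<epsilon>..t}|lebesgue. (K t s)\<^sup>2) \<ge> c * \<epsilon> powr H"
    and "\<And>i. i \<in> {1..m} \<Longrightarrow> countable (M i)"
    and "\<And>i. i \<in> {1..m} \<Longrightarrow> 1 < q i"
    and "\<And>i. i \<in> {1..m} \<Longrightarrow> in_Lq (q i) (f i)"
    and "\<And>t x. t \<in> {0..T} \<Longrightarrow> b t x = (\<Sum>i=1..m. f i x * indicator (M i) x)"
  shows "(\<exists>X. strong_solution P T A B b x0 X) \<and>
         ((\<forall>i\<in>{1..m}. bounded (range (f i))) \<longrightarrow>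
          (\<forall>X Y. strong_solution P T A B b x0 X \<longrightarrow> strong_solution P T A B b x0 Y \<longrightarrow>
             (AE \<omega> in P. \<forall>t\<in>{0..T}. X t \<omega> = Y t \<omega>)))"
proof -
  interpret brownian P T A W
    using assms(2,3) by (auto simp: brownian_def brownian_axioms_def filtered_prob_space_def)
  define S where "S = (\<Union>i\<in>{1..m}. M i)"
  have S: "countable S" unfolding S_def using assms(12) by (intro countable_UN) auto
  have b0: "b t x = 0" if "t \<in> {0..T}" "x \<notin> S" for t x
    using that assms(15)[OF that(1)] by (auto simp: S_def intro!: sum.neutral)
  have wi: "wiener_integral P W t (K t) (B t)" if "t \<in> {0..T}" for t
    using assms(7) that by (auto simp: volterra_process_def)
  have BA: "B t \<in> borel_measurable (A t)" if "t \<in> {0..T}" for t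
    using assms(5) that
    by (intro wiener_integral_measurable[OF _ _ _ wi]) (auto simp: usual_conditions_def)
  \<comment> \<open>Shared by both halves: existence applies it with \<open>C = 0\<close>,
    uniqueness with a bound on the drift.\<close>
  have no_drift: "AE \<omega> in P. set_integrable lebesgue {0..T} (\<lambda>s. b s (X s \<omega>)) \<and>
        (\<forall>t\<in>{0..T}. (LINT s:{0..t}|lebesgue. b s (X s \<omega>)) = 0)"
    if X: "adapted T A X"
      and lip: "AE \<omega> in P. \<forall>r t. 0 \<le> r \<longrightarrow> r \<le> t \<longrightarrow> t \<le> T \<longrightarrow>
        \<bar>(X t \<omega> - B t \<omega>) - (X r \<omega> - B r \<omega>)\<bar> \<le> C * (t - r)" for X C
  proof -
    have "AE \<omega> in P. AE t in lebesgue. t \<in> {0..T} \<longrightarrow> X t \<omega> \<notin> S"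
    proof (rule AE_AE_notin_countable[OF assms(1) S _ _ lip])
      show "(\<lambda>(t, \<omega>). B t \<omega>) \<in> borel_measurable (restrict_space borel {0..T} \<Otimes>\<^sub>M P)"
        using assms(7) by (simp add: volterra_process_def)
      show "X t \<in> borel_measurable P" if "t \<in> {0..T}" for t
        using X that by (intro measurable_P[of t]) (auto simp: adapted_def)
      show "AE \<omega> in P. X t \<omega> \<noteq> y" if "0 < t" "t \<le> T" for t y
      proof (rule AE_neq_of_lipschitz_drift[OF that assms(9,10), where g="K t" and B=B])
        show "wiener_integral P W t (K t) (B t)" using that by (intro wi) auto
        show "c * \<epsilon> powr H \<le> sqrt (LINT s:{t - \<epsilon>..t}|lebesgue. (K t s)\<^sup>2)" if "0 < \<epsilon>" "\<epsilon> < t" for \<epsilon>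
          using assms(11) \<open>0 < t\<close> \<open>t \<le> T\<close> that .
        show "AE \<omega> in P. \<forall>r\<in>{0..t}. \<bar>(X t \<omega> - B t \<omega>) - (X r \<omega> - B r \<omega>)\<bar> \<le> C * (t - r)"
          using lip by eventually_elim (use that in auto)
      qed (use that X BA in \<open>auto simp: adapted_def\<close>)
    qed
    then show ?thesis
    proof eventually_elim
      case (elim \<omega>)
      then have "AE s in lebesgue. s \<in> {0..T} \<longrightarrow> b s (X s \<omega>) = 0"
        by eventually_elim (use b0 in auto)
      then show ?case using set_integral_vanishing_AE[of T "\<lambda>s. b s (X s \<omega>)"] by blast
    qed
  qed
  \<comment> \<open>Here \<open>X - B\<close> is the constant \<open>x0\<close>, hence Lipschitz
    with constant 0, and the drift integral vanishes.\<close>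
  have "strong_solution P T A B b x0 (\<lambda>t \<omega>. x0 + B t \<omega>)"
    unfolding strong_solution_def
  proof
    show ad: "adapted T A (\<lambda>t \<omega>. x0 + B t \<omega>)"
      unfolding adapted_def using BA by auto
    show "AE \<omega> in P. set_integrable lebesgue {0..T} (\<lambda>s. b s (x0 + B s \<omega>)) \<and>
        (\<forall>t\<in>{0..T}. x0 + B t \<omega> = x0 + (LINT s:{0..t}|lebesgue. b s (x0 + B s \<omega>)) + B t \<omega>)"
      using no_drift[OF ad, of 0] by (auto elim: eventually_mono)
  qed
  \<comment> \<open>A bounded drift makes its integral Lipschitz in time, so \<open>no_drift\<close>
    applies to every solution and identifies it with \<open>x0 + B\<close>.\<close>
  moreover have "AE \<omega> in P. \<forall>t\<in>{0..T}. X t \<omega> = x0 + B t \<omega>"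
    if bd: "\<forall>i\<in>{1..m}. bounded (range (f i))" and X: "strong_solution P T A B b x0 X" for X
  proof -
    obtain F where F: "\<And>i x. i \<in> {1..m} \<Longrightarrow> \<bar>f i x\<bar> \<le> F i"
      using bd unfolding bounded_iff by (metis rangeI real_norm_def)
    define C where "C = (\<Sum>i=1..m. F i)"
    have bC: "\<bar>b t x\<bar> \<le> C" if "t \<in> {0..T}" for t x
      unfolding assms(15)[OF that] C_def
      \<comment> \<open>The second fact gives \<open>0 \<le> F i\<close>, which covers points
        outside \<open>M i\<close>.\<close>
      using F order_trans[OF abs_ge_zero F] by (intro sum_abs[THEN order_trans] sum_mono) (auto simp: indicator_def)
    have eq: "AE \<omega> in P. set_integrable lebesgue {0..T} (\<lambda>s. b s (X s \<omega>)) \<and>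
        (\<forall>t\<in>{0..T}. X t \<omega> = x0 + (LINT s:{0..t}|lebesgue. b s (X s \<omega>)) + B t \<omega>)"
      and ad: "adapted T A X"
      using X by (auto simp: strong_solution_def)
    have "AE \<omega> in P. \<forall>r t. 0 \<le> r \<longrightarrow> r \<le> t \<longrightarrow> t \<le> T \<longrightarrow>
        \<bar>(X t \<omega> - B t \<omega>) - (X r \<omega> - B r \<omega>)\<bar> \<le> C * (t - r)"
      using eq
    proof eventually_elim
      case (elim \<omega>)
      show ?case
        using set_integral_lipschitz[of T "\<lambda>s. b s (X s \<omega>)" C] elim bC by auto
    qed
    from no_drift[OF ad this] eq show ?thesis
      by eventually_elim auto
  qed
  ultimately show ?thesis
  proof (intro conjI impI allI, goal_cases)
    case (2 X Y)
    then have "AE \<omega> in P. \<forall>t\<in>{0..T}. X t \<omega> = x0 + B t \<omega>" "AE \<omega> in P. \<forall>t\<in>{0..T}. Y t \<omega> = x0 + B t \<omega>"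
      by auto
    then show ?case by eventually_elim auto
  qed blast
qed

end
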